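(* Let $A=(A_{\alpha\beta})$ be an $n\times m$ partitioned matrix over a field $\mathbf{F}$ of type $(n_1,\dots,n_\mu;m_1,\dots,m_\nu)$ with $\operatorname{rank}A_{\alpha\beta}\le1$ for all $\alpha,\beta$. Then: (1) a stable subspace $(X,Y)$ is maximum if and only if $(X,Y)=(X(H),Y(K))$ for some minimum cover $(H,K)$ in $(\mathbf{M}(\Pi),\mathbf{M}(\Sigma),G)$; (2) the maximum of $\dim X+\dim Y$ over stable subspaces $(X,Y)$ equals $n+m$ minus the maximum size of an independent matching in $(\mathbf{M}(\Pi),\mathbf{M}(\Sigma),G)$.
   Context: Write $U=\mathbf{F}^n=U_1\oplus\cdots\oplus U_\mu$ and $V=\mathbf{F}^m=V_1\oplus\cdots\oplus V_\nu$, where $U_\alpha$ ($V_\beta$) consists of vectors supported on the $\alpha$-th row block (the $\beta$-th column block); $A_{\alpha\beta}$ is viewed as a bilinear form on $U_\alpha\times V_\beta$. Let $\mathcal{L}$ be the set of subspaces $X=X_1\oplus\cdots\oplus X_\mu$ of $U$ with $X_\alpha\subseteq U_\alpha$, and $\mathcal{M}$ the set of subspaces $Y=Y_1\oplus\cdots\oplus Y_\nu$ of $V$ with $Y_\beta\subseteq V_\beta$. $(X,Y)\in\mathcal{L}\times\mathcal{M}$ is stable if $x^{\top}Ay=0$ for all $x\in X,y\in Y$ (equivalently $A_{\alpha\beta}(X_\alpha,Y_\beta)=\{0\}$ for all $\alpha,\beta$), and maximum if $\dim X+\dim Y$ is maximal among stable pairs. For each $\alpha$, let $\Pi_\alpha$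 be the set of hyperplanes of $U_\alpha$ of the form $\ker A_{\alpha\beta}^{\top}$ for some $\beta$ with $\operatorname{rank}A_{\alpha\beta}=1$; for each $\beta$, let $\Sigma_\beta$ be the set of hyperplanes of $V_\beta$ of the form $\ker A_{\alpha\beta}$ for some $\alpha$ with $\operatorname{rank}A_{\alpha\beta}=1$. Let $\Pi$ and $\Sigma$ be the disjoint unions of the $\Pi_\alpha$ and of the $\Sigma_\beta$. $G=(\Pi,\Sigma,E)$ is the bipartite graph in which $(\pi,\sigma)\in\Pi_\alpha\times\Sigma_\beta$ is an edge iff $\pi=\ker A_{\alpha\beta}^{\top}$ and $\sigma=\ker A_{\alpha\beta}$. For $H\subseteq\Pi$, $X(H)=\bigoplus_\alpha X(H)_\alpha$ where $X(H)_\alpha$ is the intersection of the hyperplanes in $H\cap\Pi_\alpha$ (equal to $U_\alpha$ if none); similarly for $K\subseteq\Sigma$, $Y(K)=\bigoplus_\beta Y(K)_\beta$ with $Y(K)_\beta$ the intersection of the hyperplanes in $K\cap\Sigma_\beta$. $\mathbf{M}(\Pi_\alpha)$ is the matroid on $\Pi_\alpha$ in which $H$ is independent iff $|H|=\dim U_\alpha-\dim\bigcap_{\pi\in H}\pi$; similarly $\mathbf{M}(\Sigma_\beta)$; $\mathbf{M}(\Pi)$ and $\mathbf{M}(\Sigma)$ are the direct sums of these matroids over $\alpha$, resp. $\beta$, with rank functions $\rho^+,\rho^-$. A matching $M\subseteq E$ (edges pairwise disjoint) is independent if the set of its endpoints in $\Pi$ is independent in $\mathbf{M}(\Pi)$ and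 the set of its endpoints in $\Sigma$ is independent in $\mathbf{M}(\Sigma)$. A cover is a pair $(H,K)$, $H\subseteq\Pi$, $K\subseteq\Sigma$, such that every edge of $G$ has an endpoint in $H\cup K$; it is minimum if it minimizes $\rho^+(H)+\rho^-(K)$ over all covers. *)

theory Defs
  imports "HOL-Analysis.Analysis"
begin

text \<open>
  A partitioned matrix is a matrix \<open>A :: 'a^'m^'n\<close> (rows indexed by \<open>'n\<close>, columns by \<open>'m\<close>)
  together with labellings \<open>r :: 'n \<Rightarrow> 'p\<close> and \<open>c :: 'm \<Rightarrow> 'q\<close> of the row and column indices by
  block indices; thus \<open>n\<^sub>\<alpha> = card (r -` {\<alpha>})\<close> and \<open>m\<^sub>\<beta> = card (c -` {\<beta>})\<close>. The labellings are
  arbitrary, so blocks need not be intervals of indices.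
\<close>

definition block_space :: "('n::finite \<Rightarrow> 'p::finite) \<Rightarrow> 'p \<Rightarrow> ('a::field^'n) set" where
  "block_space r \<alpha> = {x. \<forall>i. x $ i \<noteq> 0 \<longrightarrow> r i = \<alpha>}"

text \<open>
  The block with indices \<open>\<alpha>, \<beta>\<close> is padded by zeros to the full size, which does not affect its
  rank; its kernels are accordingly taken inside the block spaces.
\<close>

definition block ::
  "'a::field^'m::finite^'n::finite \<Rightarrow> ('n \<Rightarrow> 'p::finite) \<Rightarrow> ('m \<Rightarrow> 'q::finite) \<Rightarrow> 'p \<Rightarrow> 'q \<Rightarrow> 'a^'m^'n"
  where "block A r c \<alpha> \<beta> = (\<chi> i j. if r i = \<alpha> \<and> c j = \<beta> then A $ i $ j else 0)"

definition right_ker ::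
  "'a::field^'m::finite^'n::finite \<Rightarrow> ('n \<Rightarrow> 'p::finite) \<Rightarrow> ('m \<Rightarrow> 'q::finite) \<Rightarrow> 'p \<Rightarrow> 'q \<Rightarrow> ('a^'m) set"
  where "right_ker A r c \<alpha> \<beta> = {y \<in> block_space c \<beta>. block A r c \<alpha> \<beta> *v y = 0}"

definition left_ker ::
  "'a::field^'m::finite^'n::finite \<Rightarrow> ('n \<Rightarrow> 'p::finite) \<Rightarrow> ('m \<Rightarrow> 'q::finite) \<Rightarrow> 'p \<Rightarrow> 'q \<Rightarrow> ('a^'n) set"
  where "left_ker A r c \<alpha> \<beta> = {x \<in> block_space r \<alpha>. transpose (block A r c \<alpha> \<beta>) *v x = 0}"

text \<open>For \<open>X \<alpha> \<subseteq> block_space r \<alpha>\<close> the sum is automatically direct.\<close>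

definition block_sum :: "('p::finite \<Rightarrow> ('a::field^'n::finite) set) \<Rightarrow> ('a^'n) set" where
  "block_sum X = {\<Sum>\<alpha>\<in>UNIV. x \<alpha> | x. \<forall>\<alpha>. x \<alpha> \<in> X \<alpha>}"

definition block_subspaces :: "('n::finite \<Rightarrow> 'p::finite) \<Rightarrow> ('a::field^'n) set set" where
  "block_subspaces r =
    {block_sum X | X. \<forall>\<alpha>. vec.subspace (X \<alpha>) \<and> X \<alpha> \<subseteq> block_space r \<alpha>}"

definition bilin :: "'a::field^'m::finite^'n::finite \<Rightarrow> 'a^'n \<Rightarrow> 'a^'m \<Rightarrow> 'a" where
  "bilin A x y = (\<Sum>i\<in>UNIV. x $ i * (A *v y) $ i)"

definition stable_pair ::
  "'a::field^'m::finite^'n::finite \<Rightarrow> ('n \<Rightarrow> 'p::finite) \<Rightarrow> ('m \<Rightarrow> 'q::finite) \<Rightarrow>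
    ('a^'n) set \<Rightarrow> ('a^'m) set \<Rightarrow> bool"
  where "stable_pair A r c X Y \<longleftrightarrow>
    X \<in> block_subspaces r \<and> Y \<in> block_subspaces c \<and> (\<forall>x\<in>X. \<forall>y\<in>Y. bilin A x y = 0)"

definition maximum_stable_pair ::
  "'a::field^'m::finite^'n::finite \<Rightarrow> ('n \<Rightarrow> 'p::finite) \<Rightarrow> ('m \<Rightarrow> 'q::finite) \<Rightarrow>
    ('a^'n) set \<Rightarrow> ('a^'m) set \<Rightarrow> bool"
  where "maximum_stable_pair A r c X Y \<longleftrightarrow> stable_pair A r c X Y \<and>
    (\<forall>X' Y'. stable_pair A r c X' Y' \<longrightarrow> vec.dim X' + vec.dim Y' \<le> vec.dim X + vec.dim Y)"

text \<open>
  In the disjoint unions, a hyperplane is tagged with the index of the block space it lives in.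
\<close>

definition row_hyps ::
  "'a::field^'m::finite^'n::finite \<Rightarrow> ('n \<Rightarrow> 'p::finite) \<Rightarrow> ('m \<Rightarrow> 'q::finite) \<Rightarrow> ('p \<times> ('a^'n) set) set"
  where "row_hyps A r c = (SIGMA \<alpha>:UNIV. {left_ker A r c \<alpha> \<beta> | \<beta>. rank (block A r c \<alpha> \<beta>) = 1})"

definition col_hyps ::
  "'a::field^'m::finite^'n::finite \<Rightarrow> ('n \<Rightarrow> 'p::finite) \<Rightarrow> ('m \<Rightarrow> 'q::finite) \<Rightarrow> ('q \<times> ('a^'m) set) set"
  where "col_hyps A r c = (SIGMA \<beta>:UNIV. {right_ker A r c \<alpha> \<beta> | \<alpha>. rank (block A r c \<alpha> \<beta>) = 1})"

definition edges ::
  "'a::field^'m::finite^'n::finite \<Rightarrow> ('n \<Rightarrow> 'p::finite) \<Rightarrow> ('m \<Rightarrow> 'q::finite) \<Rightarrow>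
    (('p \<times> ('a^'n) set) \<times> ('q \<times> ('a^'m) set)) set"
  where "edges A r c = {((\<alpha>, \<pi>), (\<beta>, \<sigma>)) | \<alpha> \<pi> \<beta> \<sigma>.
    (\<alpha>, \<pi>) \<in> row_hyps A r c \<and> (\<beta>, \<sigma>) \<in> col_hyps A r c \<and>
    \<pi> = left_ker A r c \<alpha> \<beta> \<and> \<sigma> = right_ker A r c \<alpha> \<beta>}"

text \<open>
  The following are used with \<open>H\<close> a set of tagged hyperplanes on either side (\<open>r\<close> standing for
  the row or the column labelling). Intersecting with the block space makes the intersection of
  no hyperplanes the whole block space.
\<close>

definition hyp_inter ::
  "('n::finite \<Rightarrow> 'p::finite) \<Rightarrow> ('p \<times> ('a::field^'n) set) set \<Rightarrow> 'p \<Rightarrow> ('a^'n) set" where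
  "hyp_inter r H \<alpha> = block_space r \<alpha> \<inter> \<Inter>{\<pi>. (\<alpha>, \<pi>) \<in> H}"

definition hyp_sum ::
  "('n::finite \<Rightarrow> 'p::finite) \<Rightarrow> ('p \<times> ('a::field^'n) set) set \<Rightarrow> ('a^'n) set" where
  "hyp_sum r H = block_sum (hyp_inter r H)"

text \<open>
  Independence in the direct sum, over all \<open>\<alpha>\<close>, of the hyperplane matroids of the block spaces,
  with ground set \<open>P\<close>.
\<close>

definition hyp_indep ::
  "('n::finite \<Rightarrow> 'p::finite) \<Rightarrow> ('p \<times> ('a::field^'n) set) set \<Rightarrow> ('p \<times> ('a^'n) set) set \<Rightarrow> bool" where
  "hyp_indep r P H \<longleftrightarrow> H \<subseteq> P \<and>
    (\<forall>\<alpha>. card {\<pi>. (\<alpha>, \<pi>) \<in> H} =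
      vec.dim (block_space r \<alpha> :: ('a^'n) set) - vec.dim (hyp_inter r H \<alpha>))"

definition rank_of :: "('h set \<Rightarrow> bool) \<Rightarrow> 'h set \<Rightarrow> nat" where
  "rank_of indep H = Max {card I | I. I \<subseteq> H \<and> indep I}"

definition row_indep ::
  "'a::field^'m::finite^'n::finite \<Rightarrow> ('n \<Rightarrow> 'p::finite) \<Rightarrow> ('m \<Rightarrow> 'q::finite) \<Rightarrow>
    ('p \<times> ('a^'n) set) set \<Rightarrow> bool"
  where "row_indep A r c = hyp_indep r (row_hyps A r c)"

definition col_indep ::
  "'a::field^'m::finite^'n::finite \<Rightarrow> ('n \<Rightarrow> 'p::finite) \<Rightarrow> ('m \<Rightarrow> 'q::finite) \<Rightarrow>
    ('q \<times> ('a^'m) set) set \<Rightarrow> bool"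
  where "col_indep A r c = hyp_indep c (col_hyps A r c)"

definition matching :: "('h \<times> 'k) set \<Rightarrow> ('h \<times> 'k) set \<Rightarrow> bool" where
  "matching E M \<longleftrightarrow> M \<subseteq> E \<and>
    (\<forall>e\<in>M. \<forall>e'\<in>M. e \<noteq> e' \<longrightarrow> fst e \<noteq> fst e' \<and> snd e \<noteq> snd e')"

definition indep_matching ::
  "'a::field^'m::finite^'n::finite \<Rightarrow> ('n \<Rightarrow> 'p::finite) \<Rightarrow> ('m \<Rightarrow> 'q::finite) \<Rightarrow>
    (('p \<times> ('a^'n) set) \<times> ('q \<times> ('a^'m) set)) set \<Rightarrow> bool"
  where "indep_matching A r c M \<longleftrightarrow> matching (edges A r c) M \<and>
    row_indep A r c (fst ` M) \<and> col_indep A r c (snd ` M)"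

definition cover ::
  "'a::field^'m::finite^'n::finite \<Rightarrow> ('n \<Rightarrow> 'p::finite) \<Rightarrow> ('m \<Rightarrow> 'q::finite) \<Rightarrow>
    ('p \<times> ('a^'n) set) set \<Rightarrow> ('q \<times> ('a^'m) set) set \<Rightarrow> bool"
  where "cover A r c H K \<longleftrightarrow> H \<subseteq> row_hyps A r c \<and> K \<subseteq> col_hyps A r c \<and>
    (\<forall>(\<pi>, \<sigma>)\<in>edges A r c. \<pi> \<in> H \<or> \<sigma> \<in> K)"

definition cover_rank ::
  "'a::field^'m::finite^'n::finite \<Rightarrow> ('n \<Rightarrow> 'p::finite) \<Rightarrow> ('m \<Rightarrow> 'q::finite) \<Rightarrow>
    ('p \<times> ('a^'n) set) set \<Rightarrow> ('q \<times> ('a^'m) set) set \<Rightarrow> nat"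
  where "cover_rank A r c H K = rank_of (row_indep A r c) H + rank_of (col_indep A r c) K"

definition minimum_cover ::
  "'a::field^'m::finite^'n::finite \<Rightarrow> ('n \<Rightarrow> 'p::finite) \<Rightarrow> ('m \<Rightarrow> 'q::finite) \<Rightarrow>
    ('p \<times> ('a^'n) set) set \<Rightarrow> ('q \<times> ('a^'m) set) set \<Rightarrow> bool"
  where "minimum_cover A r c H K \<longleftrightarrow> cover A r c H K \<and>
    (\<forall>H' K'. cover A r c H' K' \<longrightarrow> cover_rank A r c H K \<le> cover_rank A r c H' K')"

text \<open>The maxima in \<open>rank_of\<close> and in the theorem are taken over finite nonempty sets.\<close>

lemma finite_row_hyps: "finite (row_hyps A r c)"
  unfolding row_hyps_def by (auto simp: setcompr_eq_image)

lemma finite_col_hyps: "finite (col_hyps A r c)"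
  unfolding col_hyps_def by (auto simp: setcompr_eq_image)

lemma finite_edges: "finite (edges A r c)"
  by (rule finite_subset[OF _ finite_cartesian_product[OF finite_row_hyps finite_col_hyps]])
    (auto simp: edges_def)

lemma hyp_indep_empty: "hyp_indep r P {}"
  by (simp add: hyp_indep_def hyp_inter_def)

lemma rank_of_wf:
  assumes "finite H" and "indep {}"
  shows "finite {card I | I. I \<subseteq> H \<and> indep I}" "{card I | I. I \<subseteq> H \<and> indep I} \<noteq> {}"
proof -
  have "{card I | I. I \<subseteq> H \<and> indep I} \<subseteq> card ` Pow H" by auto
  then show "finite {card I | I. I \<subseteq> H \<and> indep I}"
    using assms(1) by (meson finite_Pow_iff finite_imageI finite_subset)
  show "{card I | I. I \<subseteq> H \<and> indep I} \<noteq> {}" using assms(2) by blast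
qed

lemma indep_matchings_wf:
  "finite {card M | M. indep_matching A r c M}" "{card M | M. indep_matching A r c M} \<noteq> {}"
proof -
  have "{card M | M. indep_matching A r c M} \<subseteq> card ` Pow (edges A r c)"
    by (auto simp: indep_matching_def matching_def)
  then show "finite {card M | M. indep_matching A r c M}"
    using finite_edges by (meson finite_Pow_iff finite_imageI finite_subset)
  have "indep_matching A r c {}"
    by (simp add: indep_matching_def matching_def row_indep_def col_indep_def hyp_indep_empty)
  then show "{card M | M. indep_matching A r c M} \<noteq> {}" by blast
qed

lemma vec_dim_le: "vec.dim (X :: ('a::field^'n::finite) set) \<le> CARD('n)"
  using vec.dim_subset[OF subset_UNIV, of X] by (simp add: card_cart_basis)

lemma stable_dims_wf:
  fixes A :: "'a::field^'m::finite^'n::finite"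
  shows "finite {vec.dim X + vec.dim Y | X Y. stable_pair A r c X Y}"
    "{vec.dim X + vec.dim Y | X Y. stable_pair A r c X Y} \<noteq> {}"
proof -
  have "{vec.dim X + vec.dim Y | X Y. stable_pair A r c X Y} \<subseteq> {.. CARD('n) + CARD('m)}"
    by (auto intro!: add_mono simp: vec_dim_le)
  then show "finite {vec.dim X + vec.dim Y | X Y. stable_pair A r c X Y}"
    by (rule finite_subset) simp
  have z: "{0 :: 'a^'i} \<in> block_subspaces f" for f :: "'i::finite \<Rightarrow> 'j::finite"
  proof -
    have "block_sum (\<lambda>_::'j. {0 :: 'a^'i}) = {0}"
      by (auto simp: block_sum_def intro!: exI[of _ "\<lambda>_. 0"])
    moreover have "\<forall>\<alpha>::'j. vec.subspace {0} \<and> {0 :: 'a^'i} \<subseteq> block_space f \<alpha>"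
      by (auto simp: block_space_def vec.subspace_def)
    ultimately show ?thesis unfolding block_subspaces_def
      by (intro CollectI exI[of _ "\<lambda>_::'j. {0 :: 'a^'i}"] conjI) simp_all
  qed
  have "stable_pair A r c {0} {0}"
    by (simp add: stable_pair_def z bilin_def)
  then show "{vec.dim X + vec.dim Y | X Y. stable_pair A r c X Y} \<noteq> {}" by blast
qed

end

theory Submission
  imports Defs
begin

text \<open>
  The codimension of \<open>X(H)\<close> is a matroid rank function of \<open>H\<close>: submodularity is the dimension
  formula for sums and intersections of subspaces, and each hyperplane costs at most one dimension.
  It is the rank function of the hyperplane matroid, so a cover \<open>(H, K)\<close> of rank \<open>k\<close> has
  \<open>dim X(H) + dim Y(K) = n + m - k\<close>. A bilinear form of rank one is a product of two linear forms;
  hence it vanishes on \<open>X \<times> Y\<close> iff \<open>X\<close> lies in its left kernel or \<open>Y\<close> in its right kernel. So a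
  stable pair is contained in \<open>(X(H), Y(K))\<close> for the cover formed by all hyperplanes containing
  \<open>X\<close> or \<open>Y\<close>, and conversely every cover gives a stable pair; thus maximum stable pairs are those
  of minimum covers. The minimum cover rank equals the maximum size of an independent matching by the
  matroid intersection theorem on the edge set, for the two matroids pulled back along the endpoint
  maps: a set of edges that is independent in both is precisely an independent matching.
\<close>

section \<open>Matroid intersection\<close>

text \<open>The rank axioms, with the bound on singletons in place of
  \<open>f X \<le> card X\<close>; the independent sets are those with \<open>f I = card I\<close>.
  Only values on subsets of \<open>E\<close> are constrained, so the same \<open>f\<close> serves
  every smaller ground set.\<close>

definition matroid_rank :: "'e set \<Rightarrow> ('e set \<Rightarrow> nat) \<Rightarrow> bool" where
  "matroid_rank E f \<longleftrightarrow> f {} = 0 \<and> (\<forall>e\<in>E. f {e} \<le> 1) \<and>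
    (\<forall>X Y. X \<subseteq> Y \<longrightarrow> Y \<subseteq> E \<longrightarrow> f X \<le> f Y) \<and>
    (\<forall>X Y. X \<subseteq> E \<longrightarrow> Y \<subseteq> E \<longrightarrow> f (X \<union> Y) + f (X \<inter> Y) \<le> f X + f Y)"

lemma matroid_rank_empty: "matroid_rank E f \<Longrightarrow> f {} = 0"
  and matroid_rank_singleton: "matroid_rank E f \<Longrightarrow> e \<in> E \<Longrightarrow> f {e} \<le> 1"
  and matroid_rank_mono: "matroid_rank E f \<Longrightarrow> X \<subseteq> Y \<Longrightarrow> Y \<subseteq> E \<Longrightarrow> f X \<le> f Y"
  and matroid_rank_submodular:
    "matroid_rank E f \<Longrightarrow> X \<subseteq> E \<Longrightarrow> Y \<subseteq> E \<Longrightarrow> f (X \<union> Y) + f (X \<inter> Y) \<le> f X + f Y"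
  by (auto simp: matroid_rank_def)

lemma matroid_rank_subset: "matroid_rank E f \<Longrightarrow> E' \<subseteq> E \<Longrightarrow> matroid_rank E' f"
  unfolding matroid_rank_def by (meson subset_iff subset_trans)

lemma matroid_rank_Un_le:
  "matroid_rank E f \<Longrightarrow> X \<subseteq> E \<Longrightarrow> Y \<subseteq> E \<Longrightarrow> f (X \<union> Y) \<le> f X + f Y"
  using matroid_rank_submodular[of E f X Y] by simp

lemma matroid_rank_le_card:
  assumes "matroid_rank E f" "finite X" "X \<subseteq> E"
  shows "f X \<le> card X"
  using assms(2,3)
proof (induction X rule: finite_induct)
  case empty
  then show ?case using assms(1) by (simp add: matroid_rank_empty)
next
  case (insert x F)
  have "f (insert x F) \<le> f {x} + f F"
    using matroid_rank_Un_le[OF assms(1), of "{x}" F] insert.prems by simp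
  moreover have "f {x} \<le> 1" using matroid_rank_singleton[OF assms(1)] insert.prems by simp
  ultimately show ?case using insert by simp
qed

lemma matroid_rank_eq_0:
  assumes "matroid_rank E f" "finite X" "X \<subseteq> E" "\<And>x. x \<in> X \<Longrightarrow> f {x} = 0"
  shows "f X = 0"
  using assms(2-4)
proof (induction X rule: finite_induct)
  case empty
  then show ?case using assms(1) by (simp add: matroid_rank_empty)
next
  case (insert x X)
  then show ?case using matroid_rank_Un_le[OF assms(1), of "{x}" X] by simp
qed

text \<open>By subadditivity \<open>f I\<close> is at most \<open>f J + f (I - J)\<close>, hence at
  most \<open>card J + card (I - J) = card I\<close>; equality at the ends forces equality in each
  summand.\<close>

lemma matroid_rank_indep_subset:
  assumes "matroid_rank E f" "finite I" "I \<subseteq> E" "f I = card I" "J \<subseteq> I"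
  shows "f J = card J"
proof -
  have "f (J \<union> (I - J)) \<le> f J + f (I - J)"
    by (rule matroid_rank_Un_le[OF assms(1)]) (use assms(3,5) in auto)
  moreover have "f (I - J) \<le> card (I - J)" "f J \<le> card J"
    using matroid_rank_le_card[OF assms(1)] assms(2,3,5)
    by (meson Diff_subset finite_subset subset_trans)+
  moreover have "card I = card J + card (I - J)"
    using assms(2,5) by (metis card_Diff_subset card_mono finite_subset le_add_diff_inverse)
  moreover have "J \<union> (I - J) = I" using assms(5) by blast
  ultimately show ?thesis using assms(4) by simp
qed

text \<open>This is the free matroid, in which every set is independent.\<close>

lemma matroid_rank_card: "finite E \<Longrightarrow> matroid_rank E card"
  unfolding matroid_rank_def
  by (metis add.commute card.empty card_Un_Int card_mono finite_subset is_singletonI is_singleton_altdef order_refl)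

text \<open>The rank function of the contraction by the nonloop \<open>e\<close>. The ground set is
  kept, so \<open>e\<close> itself turns into a loop.\<close>

lemma matroid_rank_contract:
  assumes f: "matroid_rank E f" and e: "e \<in> E" "f {e} = 1"
  shows "matroid_rank E (\<lambda>X. f (insert e X) - 1)"
  unfolding matroid_rank_def
proof (intro conjI ballI allI impI)
  \<comment> \<open>Positivity makes all the truncated subtractions exact.\<close>
  have pos: "1 \<le> f (insert e X)" if "X \<subseteq> E" for X
    using matroid_rank_mono[OF f, of "{e}" "insert e X"] that e by simp
  show "f {e} - 1 = 0" using e by simp
  show "f {e, x} - 1 \<le> 1" if "x \<in> E" for x
    using matroid_rank_le_card[OF f, of "{e, x}"] that e card_insert_le_m1[of 2 "{x}" e] by simp
  show "f (insert e X) - 1 \<le> f (insert e Y) - 1" if "X \<subseteq> Y" "Y \<subseteq> E" for X Y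
    using matroid_rank_mono[OF f, of "insert e X" "insert e Y"] that e
    by (simp add: subset_insertI2 diff_le_mono)
  show "f (insert e (X \<union> Y)) - 1 + (f (insert e (X \<inter> Y)) - 1) \<le> f (insert e X) - 1 + (f (insert e Y) - 1)"
    if "X \<subseteq> E" "Y \<subseteq> E" for X Y
  proof -
    have "insert e X \<union> insert e Y = insert e (X \<union> Y)" "insert e X \<inter> insert e Y = insert e (X \<inter> Y)"
      by auto
    then show ?thesis
      using matroid_rank_submodular[OF f, of "insert e X" "insert e Y"] that e
        pos[of X] pos[of Y] pos[of "X \<union> Y"] pos[of "X \<inter> Y"]
      by (simp add: le_infI1)
  qed
qed

text \<open>The matroid pulled back along \<open>g\<close>. A finite set is independent in it iff
  \<open>g\<close> is injective on it and its image is independent; this is what will turn common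
  independence into the matching condition.\<close>

lemma matroid_rank_image:
  assumes "matroid_rank P f" "g ` E \<subseteq> P"
  shows "matroid_rank E (\<lambda>F. f (g ` F))"
  unfolding matroid_rank_def
proof (intro conjI ballI allI impI)
  show "f (g ` {}) = 0" using matroid_rank_empty[OF assms(1)] by simp
  show "f (g ` {e}) \<le> 1" if "e \<in> E" for e
    using matroid_rank_singleton[OF assms(1)] that assms(2) by auto
  show "f (g ` X) \<le> f (g ` Y)" if "X \<subseteq> Y" "Y \<subseteq> E" for X Y
    using matroid_rank_mono[OF assms(1), of "g ` X" "g ` Y"] that assms(2) by blast
  show "f (g ` (X \<union> Y)) + f (g ` (X \<inter> Y)) \<le> f (g ` X) + f (g ` Y)" if "X \<subseteq> E" "Y \<subseteq> E" for X Y
  proof -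
    have P: "g ` X \<subseteq> P" "g ` Y \<subseteq> P" using that assms(2) by blast+
    \<comment> \<open>The image of an intersection can be smaller than the intersection of the
      images; monotonicity absorbs the difference.\<close>
    have "f (g ` (X \<inter> Y)) \<le> f (g ` X \<inter> g ` Y)"
      by (rule matroid_rank_mono[OF assms(1)]) (use P in auto)
    then show ?thesis
      using matroid_rank_submodular[OF assms(1) P] by (simp add: image_Un)
  qed
qed

text \<open>
  Induction on the ground set: pick a common nonloop \<open>e\<close>. If both deleting and contracting \<open>e\<close>
  lowered the minimum too far, the two offending sets \<open>F\<^sub>1\<close>, \<open>F\<^sub>2\<close> could be uncrossed by
  submodularity, contradicting the hypothesis for \<open>F\<^sub>1 \<union> F\<^sub>2 \<union> {e}\<close> and \<open>F\<^sub>1 \<inter> F\<^sub>2\<close>.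
\<close>

lemma matroid_intersection:
  assumes "finite E" "matroid_rank E f" "matroid_rank E g"
    and "\<And>F. F \<subseteq> E \<Longrightarrow> k \<le> f F + g (E - F)"
  shows "\<exists>I\<subseteq>E. card I = k \<and> f I = k \<and> g I = k"
  using assms
proof (induction "card E" arbitrary: E f g k rule: less_induct)
  case less
  note f = less.prems(2) and g = less.prems(3) and k = less.prems(4)
  show ?case
  proof (cases "\<exists>e\<in>E. f {e} = 1 \<and> g {e} = 1")
    case False
    \<comment> \<open>Every element is a loop of one of the two matroids. Taking for
      \<open>F\<close> the loops of \<open>f\<close> leaves only loops of \<open>g\<close> outside,
      so the hypothesis forces \<open>k = 0\<close>.\<close>
    define F where "F = {e \<in> E. f {e} = 0}"
    have "f F = 0"
      by (rule matroid_rank_eq_0[OF f]) (use less.prems(1) in \<open>simp_all add: F_def\<close>)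
    moreover have "g {x} = 0" if "x \<in> E - F" for x
    proof -
      have "f {x} \<le> 1" "g {x} \<le> 1" "f {x} \<noteq> 0"
        using that matroid_rank_singleton[OF f] matroid_rank_singleton[OF g] by (auto simp: F_def)
      moreover have "\<not> (f {x} = 1 \<and> g {x} = 1)" using False that by blast
      ultimately show ?thesis by linarith
    qed
    then have "g (E - F) = 0"
      using matroid_rank_eq_0[OF g, of "E - F"] less.prems(1) by blast
    ultimately have "k = 0" using k[of F] by (auto simp: F_def)
    then show ?thesis
      using matroid_rank_empty[OF f] matroid_rank_empty[OF g] by (intro exI[of _ "{}"]) simp
  next
    case True
    then obtain e where e: "e \<in> E" "f {e} = 1" "g {e} = 1" by blast
    define D where "D = E - {e}"
    have D: "D \<subseteq> E" "e \<notin> D" "finite D" "card D < card E" "insert e D = E"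
      using e(1) less.prems(1) card_Diff1_less[of E e] by (auto simp: D_def)
    define f' where "f' X = f (insert e X) - 1" for X
    define g' where "g' X = g (insert e X) - 1" for X
    have pos: "1 \<le> f (insert e X)" "1 \<le> g (insert e X)" if "X \<subseteq> D" for X
      using matroid_rank_mono[OF f, of "{e}" "insert e X"] matroid_rank_mono[OF g, of "{e}" "insert e X"]
        that e D(1) by auto
    \<comment> \<open>Either the bound \<open>k\<close> survives deletion of \<open>e\<close>, or
      the bound \<open>k - 1\<close> survives contraction, or each fails at some set.\<close>
    consider (del) "\<And>F. F \<subseteq> D \<Longrightarrow> k \<le> f F + g (D - F)"
      | (con) "\<And>F. F \<subseteq> D \<Longrightarrow> k - 1 \<le> f' F + g' (D - F)"
      | (no) F\<^sub>1 F\<^sub>2 where "F\<^sub>1 \<subseteq> D" "F\<^sub>2 \<subseteq> D" "f F\<^sub>1 + g (D - F\<^sub>1) < k"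
          "f' F\<^sub>2 + g' (D - F\<^sub>2) < k - 1"
      by (metis linorder_not_less)
    then show ?thesis
    proof cases
      case del
      have "\<exists>I\<subseteq>D. card I = k \<and> f I = k \<and> g I = k"
        using less.hyps[OF D(4,3) matroid_rank_subset[OF f D(1)] matroid_rank_subset[OF g D(1)]] del
        by blast
      then show ?thesis using D(1) by blast
    next
      case con
      have "matroid_rank D f'" "matroid_rank D g'"
        using matroid_rank_subset[OF matroid_rank_contract D(1)] f g e
        unfolding f'_def[abs_def] g'_def[abs_def] by blast+
      then have "\<exists>I\<subseteq>D. card I = k - 1 \<and> f' I = k - 1 \<and> g' I = k - 1"
        using less.hyps[OF D(4,3), of f' g' "k - 1"] con by blast
      then obtain I where I: "I \<subseteq> D" "card I = k - 1" "f' I = k - 1" "g' I = k - 1"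
        by blast
      have "e \<notin> I" "finite I" using I(1) D finite_subset by auto
      then have "card (insert e I) = k - 1 + 1" using I(2) by simp
      moreover have "f (insert e I) = k - 1 + 1" "g (insert e I) = k - 1 + 1"
        using pos[OF I(1)] I(3,4) by (auto simp: f'_def g'_def)
      ultimately have I': "card (insert e I) = k - 1 + 1 \<and> f (insert e I) = k - 1 + 1 \<and> g (insert e I) = k - 1 + 1"
        by blast
      show ?thesis
      proof (cases "k = 0")
        \<comment> \<open>Here \<open>k - 1 + 1\<close> is 1 because subtraction truncates, so the
          empty set is taken instead.\<close>
        case True
        then show ?thesis
          using matroid_rank_empty[OF f] matroid_rank_empty[OF g] by (intro exI[of _ "{}"]) simp
      next
        case False
        then show ?thesis using I' I(1) D e(1) by (intro exI[of _ "insert e I"]) auto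
      qed
    next
      case no
      \<comment> \<open>The two failing sums are at most \<open>k - 1\<close> and, after undoing the
        contraction in both matroids, at most \<open>k\<close>. The uncrossed sets would each need
        \<open>k\<close>, which makes \<open>2 * k\<close> against \<open>2 * k - 1\<close>.\<close>
      have s: "insert e F\<^sub>2 \<subseteq> E" "F\<^sub>1 \<subseteq> E" "D - F\<^sub>1 \<subseteq> E" "insert e (D - F\<^sub>2) \<subseteq> E"
        using no D(1) e(1) by auto
      have "f (F\<^sub>1 \<union> insert e F\<^sub>2) + f (F\<^sub>1 \<inter> insert e F\<^sub>2) \<le> f F\<^sub>1 + f (insert e F\<^sub>2)"
        using matroid_rank_submodular[OF f s(2,1)] .
      moreover have "g ((D - F\<^sub>1) \<union> insert e (D - F\<^sub>2)) + g ((D - F\<^sub>1) \<inter> insert e (D - F\<^sub>2))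
          \<le> g (D - F\<^sub>1) + g (insert e (D - F\<^sub>2))"
        using matroid_rank_submodular[OF g s(3,4)] .
      moreover have "(D - F\<^sub>1) \<inter> insert e (D - F\<^sub>2) = E - (F\<^sub>1 \<union> insert e F\<^sub>2)"
        "(D - F\<^sub>1) \<union> insert e (D - F\<^sub>2) = E - (F\<^sub>1 \<inter> insert e F\<^sub>2)"
        using no D by (auto simp: D_def)
      moreover have "k \<le> f (F\<^sub>1 \<union> insert e F\<^sub>2) + g (E - (F\<^sub>1 \<union> insert e F\<^sub>2))"
        "k \<le> f (F\<^sub>1 \<inter> insert e F\<^sub>2) + g (E - (F\<^sub>1 \<inter> insert e F\<^sub>2))"
        using k s by (meson Un_least le_infI1)+
      moreover have "f (insert e F\<^sub>2) + g (insert e (D - F\<^sub>2)) < k + 1"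
        using no(4) pos(1)[OF no(2)] pos(2)[of "D - F\<^sub>2"] by (auto simp: f'_def g'_def)
      ultimately have False using no(3) by simp
      then show ?thesis ..
    qed
  qed
qed

text \<open>Monotonicity bounds every independent subset by \<open>f H\<close>. For the existence of
  a basis, the hypothesis of the intersection theorem is just subadditivity of
  \<open>f\<close>.\<close>

lemma rank_of_eq_matroid_rank:
  assumes "finite H" "matroid_rank H f" and indep: "\<And>I. I \<subseteq> H \<Longrightarrow> indep I \<longleftrightarrow> f I = card I"
  shows "rank_of indep H = f H"
proof -
  have "f H \<le> f F + card (H - F)" if "F \<subseteq> H" for F
  proof -
    have "f (F \<union> (H - F)) \<le> f F + f (H - F)"
      using matroid_rank_Un_le[OF assms(2), of F "H - F"] that by blast
    then show ?thesis
      using matroid_rank_le_card[OF assms(2), of "H - F"] assms(1) that by (simp add: Un_absorb1)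
  qed
  \<comment> \<open>The free matroid as second matroid yields a basis of \<open>H\<close>.\<close>
  then obtain I where I: "I \<subseteq> H" "card I = f H" "f I = f H"
    using matroid_intersection[OF assms(1,2) matroid_rank_card[OF assms(1)], of "f H"] by blast
  have "indep {}" using indep[of "{}"] matroid_rank_empty[OF assms(2)] by simp
  show ?thesis unfolding rank_of_def
  proof (rule Max_eqI)
    show "finite {card I |I. I \<subseteq> H \<and> indep I}"
      using rank_of_wf(1)[of H indep] assms(1) \<open>indep {}\<close> by blast
    show "y \<le> f H" if y: "y \<in> {card I |I. I \<subseteq> H \<and> indep I}" for y
    proof -
      obtain I where "y = card I" "I \<subseteq> H" "indep I" using y by blast
      then show ?thesis using indep[of I] matroid_rank_mono[OF assms(2), of I H] by simp
    qed
    show "f H \<in> {card I |I. I \<subseteq> H \<and> indep I}"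
      using I indep[of I] by (intro CollectI exI[of _ I]) auto
  qed
qed

section \<open>The hyperplane matroid\<close>

text \<open>If the functional does not vanish on \<open>S\<close>, then \<open>S\<close> is spanned
  by its part in the kernel and any single vector \<open>s\<close> of \<open>S\<close> outside the
  kernel.\<close>

lemma vec_dim_le_Int_hyperplane:
  fixes S :: "('a::field^'n::finite) set"
  assumes "vec.subspace S"
  shows "vec.dim S \<le> vec.dim (S \<inter> {x. (\<Sum>i\<in>UNIV. u $ i * x $ i) = 0}) + 1"
proof (cases "\<exists>s\<in>S. (\<Sum>i\<in>UNIV. u $ i * s $ i) \<noteq> 0")
  case True
  let ?d = "\<lambda>x. \<Sum>i\<in>UNIV. u $ i * x $ i"
  let ?T = "S \<inter> {x. ?d x = 0}"
  from True obtain s where s: "s \<in> S" "?d s \<noteq> 0" by blast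
  have "x \<in> vec.span (insert s ?T)" if "x \<in> S" for x
  proof -
    \<comment> \<open>Chosen so that the functional vanishes on \<open>x - a *s s\<close>.\<close>
    define a where "a = ?d x / ?d s"
    have "?d (x - a *s s) = ?d x - a * ?d s"
      by (simp add: algebra_simps sum_subtractf sum_distrib_left)
    then have "?d (x - a *s s) = 0" using s by (simp add: a_def)
    moreover have "x - a *s s \<in> S"
      using assms that s by (simp add: vec.subspace_diff vec.subspace_scale)
    ultimately have "x - a *s s \<in> vec.span (insert s ?T)" by (simp add: vec.span_base)
    moreover have "a *s s \<in> vec.span (insert s ?T)" by (simp add: vec.span_base vec.span_scale)
    ultimately have "(x - a *s s) + a *s s \<in> vec.span (insert s ?T)" by (rule vec.span_add)
    then show ?thesis by simp
  qed
  then have "S \<subseteq> vec.span (insert s ?T)" by blast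
  then have "vec.dim S \<le> vec.dim (insert s ?T)" by (rule vec.dim_mono)
  also have "\<dots> \<le> vec.dim ?T + 1" by (simp add: vec.dim_insert)
  finally show ?thesis .
next
  case False
  then have "S \<inter> {x. (\<Sum>i\<in>UNIV. u $ i * x $ i) = 0} = S" by auto
  then show ?thesis by simp
qed

section \<open>Block projections and the dimension of a block sum\<close>

definition block_proj :: "('n::finite \<Rightarrow> 'p::finite) \<Rightarrow> 'p \<Rightarrow> 'a::field^'n \<Rightarrow> 'a^'n" where
  "block_proj r \<alpha> x = (\<chi> i. if r i = \<alpha> then x $ i else 0)"

lemma block_proj_add: "block_proj r \<alpha> (x + y) = block_proj r \<alpha> x + block_proj r \<alpha> y"
  and block_proj_scale: "block_proj r \<alpha> (k *s x) = k *s block_proj r \<alpha> x"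
  and block_proj_0: "block_proj r \<alpha> 0 = 0"
  and block_proj_block_proj:
    "block_proj r \<alpha> (block_proj r \<alpha>' x) = (if \<alpha> = \<alpha>' then block_proj r \<alpha> x else 0)"
  and block_proj_in_block_space: "block_proj r \<alpha> x \<in> block_space r \<alpha>"
  by (auto simp: block_proj_def block_space_def vec_eq_iff)

lemma block_proj_sum: "block_proj r \<alpha> (\<Sum>i\<in>I. x i) = (\<Sum>i\<in>I. block_proj r \<alpha> (x i))"
  by (induction I rule: infinite_finite_induct) (simp_all add: block_proj_0 block_proj_add)

lemma sum_block_proj: "(\<Sum>\<alpha>\<in>UNIV. block_proj r \<alpha> x) = x"
  by (simp add: block_proj_def vec_eq_iff)

lemma block_proj_of_block_space:
  "x \<in> block_space r \<alpha>' \<Longrightarrow> block_proj r \<alpha> x = (if \<alpha> = \<alpha>' then x else 0)"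
  by (auto simp: block_proj_def block_space_def vec_eq_iff)

lemma block_space_subspace: "vec.subspace (block_space r \<alpha>)"
  by (simp add: vec.subspace_def block_space_def) (metis add.left_neutral)

text \<open>The summands of a vector in a direct sum are its block projections, so the existential
  over decompositions becomes a condition on each projection.\<close>

lemma block_sum_eq:
  assumes "\<And>\<alpha>. X \<alpha> \<subseteq> block_space r \<alpha>"
  shows "block_sum X = {x. \<forall>\<alpha>. block_proj r \<alpha> x \<in> X \<alpha>}"
proof (intro equalityI subsetI)
  fix x assume "x \<in> block_sum X"
  then obtain y where y: "x = (\<Sum>\<alpha>\<in>UNIV. y \<alpha>)" "\<And>\<alpha>. y \<alpha> \<in> X \<alpha>"
    by (auto simp: block_sum_def)
  have "block_proj r \<alpha> x = (\<Sum>\<alpha>'\<in>UNIV. if \<alpha> = \<alpha>' then y \<alpha>' else 0)" for \<alpha>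
    unfolding y(1) block_proj_sum
    by (rule sum.cong[OF refl])
      (use subsetD[OF assms y(2), THEN block_proj_of_block_space] in simp)
  then show "x \<in> {x. \<forall>\<alpha>. block_proj r \<alpha> x \<in> X \<alpha>}" using y(2) by simp
next
  fix x assume "x \<in> {x. \<forall>\<alpha>. block_proj r \<alpha> x \<in> X \<alpha>}"
  then show "x \<in> block_sum X"
    unfolding block_sum_def
    by (intro CollectI exI[of _ "\<lambda>\<alpha>. block_proj r \<alpha> x"]) (simp add: sum_block_proj)
qed

text \<open>Blocks are added one at a time; each new one meets the sum of the previous ones only in
  0, so the dimension formula simply adds.\<close>

lemma dim_block_sum:
  fixes X :: "'p::finite \<Rightarrow> ('a::field^'n::finite) set"
  assumes sub: "\<And>\<alpha>. vec.subspace (X \<alpha>)" and X: "\<And>\<alpha>. X \<alpha> \<subseteq> block_space r \<alpha>"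
  shows "vec.dim (block_sum X) = (\<Sum>\<alpha>\<in>UNIV. vec.dim (X \<alpha>))"
proof -
  \<comment> \<open>\<open>D B\<close> is the partial sum of the \<open>X \<alpha>\<close> over
    \<open>B\<close>, described through projections with zero prescribed outside \<open>B\<close>;
    for \<open>B = UNIV\<close> it is the block sum.\<close>
  define D where "D B = {x. \<forall>\<alpha>. block_proj r \<alpha> x \<in> (if \<alpha> \<in> B then X \<alpha> else {0})}" for B
  have subD: "vec.subspace (D B)" for B
    using sub by (auto simp: D_def vec.subspace_def block_proj_add block_proj_scale block_proj_0)
  have "vec.dim (D B) = (\<Sum>\<alpha>\<in>B. vec.dim (X \<alpha>))" if "finite B" for B
    using that
  proof (induction B rule: finite_induct)
    case empty
    have "D {} \<subseteq> {0}"
    proof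
      fix x assume "x \<in> D {}"
      then have "(\<Sum>\<alpha>\<in>UNIV. block_proj r \<alpha> x) = 0" by (simp add: D_def)
      then show "x \<in> {0}" by (simp add: sum_block_proj)
    qed
    then show ?case by (metis vec.dim_eq_0 sum.empty)
  next
    case (insert a B)
    have "{x + y | x y. x \<in> X a \<and> y \<in> D B} = D (insert a B)"
    proof (intro equalityI subsetI)
      fix z assume "z \<in> {x + y | x y. x \<in> X a \<and> y \<in> D B}"
      then obtain x y where xy: "z = x + y" "x \<in> X a" "y \<in> D B" by blast
      have px: "block_proj r \<alpha> x = (if \<alpha> = a then x else 0)" for \<alpha>
        using xy(2) X block_proj_of_block_space by blast
      have py: "block_proj r \<alpha> y \<in> (if \<alpha> \<in> B then X \<alpha> else {0})" for \<alpha>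
        using xy(3) by (simp add: D_def)
      have "block_proj r \<alpha> z \<in> (if \<alpha> \<in> insert a B then X \<alpha> else {0})" for \<alpha>
        using xy(2) insert.hyps(2) py[of \<alpha>] unfolding xy(1) block_proj_add px
        by (cases "\<alpha> = a") auto
      then show "z \<in> D (insert a B)" by (simp add: D_def)
    next
      fix z assume z: "z \<in> D (insert a B)"
      have "block_proj r \<alpha> (z - block_proj r a z) = (if \<alpha> = a then 0 else block_proj r \<alpha> z)" for \<alpha>
        by (auto simp: block_proj_def vec_eq_iff)
      moreover have "block_proj r \<alpha> z \<in> (if \<alpha> \<in> insert a B then X \<alpha> else {0})" for \<alpha>
        using z by (simp add: D_def)
      ultimately have "block_proj r \<alpha> (z - block_proj r a z) \<in> (if \<alpha> \<in> B then X \<alpha> else {0})" for \<alpha>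
        using insert.hyps(2) by (metis insert_iff singletonI)
      then have "z - block_proj r a z \<in> D B" by (simp add: D_def)
      moreover have "block_proj r a z \<in> X a" using z by (auto simp: D_def dest: spec[of _ a])
      ultimately show "z \<in> {x + y | x y. x \<in> X a \<and> y \<in> D B}"
        by (intro CollectI exI[of _ "block_proj r a z"] exI[of _ "z - block_proj r a z"]) simp
    qed
    moreover have "X a \<inter> D B \<subseteq> {0}"
    proof
      fix x assume x: "x \<in> X a \<inter> D B"
      then have "block_proj r a x = x"
        using X block_proj_of_block_space by fastforce
      moreover have "block_proj r a x = 0" using x insert.hyps(2) by (auto simp: D_def dest: spec[of _ a])
      ultimately show "x \<in> {0}" by simp
    qed
    then have "vec.dim (X a \<inter> D B) = 0" by (metis vec.dim_eq_0)
    ultimately show ?case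
      using vec.dim_sums_Int[OF sub subD, of a B] insert
      by (simp del: vec.dim_eq_0)
  qed
  from this[of UNIV] show ?thesis by (simp add: block_sum_eq[OF X] D_def)
qed

section \<open>Codimension as the rank function of the hyperplane matroid\<close>

text \<open>The preimage under the projection leaves the other blocks free. Thus hyperplanes of
  different block spaces live in one space, and \<open>X(H)\<close> becomes a plain
  intersection.\<close>

definition hyp_lift :: "('n::finite \<Rightarrow> 'p::finite) \<Rightarrow> 'p \<times> ('a::field^'n) set \<Rightarrow> ('a^'n) set" where
  "hyp_lift r h = {x. block_proj r (fst h) x \<in> snd h}"

lemma hyp_sum_eq: "hyp_sum r H = (\<Inter>h\<in>H. hyp_lift r h)"
  unfolding hyp_sum_def
  by (subst block_sum_eq[of _ r])
    (force simp: hyp_inter_def hyp_lift_def block_proj_in_block_space)+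

definition hyp_codim :: "('n::finite \<Rightarrow> 'p::finite) \<Rightarrow> ('p \<times> ('a::field^'n) set) set \<Rightarrow> nat" where
  "hyp_codim r H = CARD('n) - vec.dim (hyp_sum r H)"

lemma dim_hyp_sum: "vec.dim (hyp_sum r H :: ('a::field^'n::finite) set) + hyp_codim r H = CARD('n)"
  by (simp add: hyp_codim_def vec_dim_le)

text \<open>The functional \<open>u\<close> may vanish on the block, so codimension at most one is
  required, which is what the singleton axiom of a rank function asks for.\<close>

definition hyperplanes :: "('n::finite \<Rightarrow> 'p::finite) \<Rightarrow> ('p \<times> ('a::field^'n) set) set \<Rightarrow> bool" where
  "hyperplanes r P \<longleftrightarrow>
    (\<forall>(\<alpha>, \<pi>)\<in>P. \<exists>u. \<pi> = {x \<in> block_space r \<alpha>. (\<Sum>i\<in>UNIV. u $ i * x $ i) = 0})"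

lemma hyperplanes_lift:
  assumes "hyperplanes r P" "h \<in> P"
  obtains u where "hyp_lift r h = {x. (\<Sum>i\<in>UNIV. u $ i * x $ i) = 0}"
proof -
  obtain u where u: "snd h = {x \<in> block_space r (fst h). (\<Sum>i\<in>UNIV. u $ i * x $ i) = 0}"
    using assms by (force simp: hyperplanes_def)
  \<comment> \<open>The projection is self-adjoint for the coordinate pairing, so it moves from
    \<open>x\<close> onto \<open>u\<close>.\<close>
  have "(\<Sum>i\<in>UNIV. u $ i * block_proj r (fst h) x $ i)
      = (\<Sum>i\<in>UNIV. block_proj r (fst h) u $ i * x $ i)" for x
    by (rule sum.cong) (auto simp: block_proj_def)
  then have "hyp_lift r h = {x. (\<Sum>i\<in>UNIV. block_proj r (fst h) u $ i * x $ i) = 0}"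
    by (simp add: hyp_lift_def u block_proj_in_block_space)
  then show ?thesis by (rule that)
qed

lemma subspace_hyp_sum:
  assumes "hyperplanes r P" "H \<subseteq> P"
  shows "vec.subspace (hyp_sum r H)"
  unfolding hyp_sum_eq
proof (rule vec.subspace_Inter, safe)
  fix h assume "h \<in> H"
  then have "h \<in> P" using assms(2) by blast
  then obtain u where "hyp_lift r h = {x. (\<Sum>i\<in>UNIV. u $ i * x $ i) = 0}"
    by (rule hyperplanes_lift[OF assms(1)])
  then show "vec.subspace (hyp_lift r h)"
    by (simp add: vec.subspace_def sum.distrib distrib_left mult.left_commute[of "u $ _"]
        flip: sum_distrib_left)
qed

lemma hyp_sum_empty: "hyp_sum r {} = UNIV"
  by (simp add: hyp_sum_eq)

lemma matroid_rank_hyp_codim: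
  fixes P :: "('p::finite \<times> ('a::field^'n::finite) set) set"
  assumes P: "hyperplanes r P"
  shows "matroid_rank P (hyp_codim r)"
  unfolding matroid_rank_def
proof (intro conjI ballI allI impI)
  have dimU: "vec.dim (UNIV :: ('a^'n) set) = CARD('n)" by (simp add: card_cart_basis)
  show "hyp_codim r ({} :: ('p \<times> ('a^'n) set) set) = 0"
    unfolding hyp_codim_def hyp_sum_empty dimU by simp
  show "hyp_codim r {h} \<le> 1" if h: "h \<in> P" for h
  proof -
    obtain u where u: "hyp_lift r h = {x. (\<Sum>i\<in>UNIV. u $ i * x $ i) = 0}"
      using hyperplanes_lift P h by blast
    show ?thesis
      using vec_dim_le_Int_hyperplane[of UNIV u] dimU
      by (simp add: hyp_codim_def hyp_sum_eq u)
  qed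
  show "hyp_codim r X \<le> hyp_codim r Y" if "X \<subseteq> Y" "Y \<subseteq> P" for X Y
  proof -
    have "vec.dim (hyp_sum r Y) \<le> vec.dim (hyp_sum r X)"
      using that by (intro vec.dim_subset) (auto simp: hyp_sum_eq)
    then show ?thesis by (simp add: hyp_codim_def)
  qed
  show "hyp_codim r (X \<union> Y) + hyp_codim r (X \<inter> Y) \<le> hyp_codim r X + hyp_codim r Y"
    if "X \<subseteq> P" "Y \<subseteq> P" for X Y
  proof -
    let ?S = "hyp_sum r X" and ?T = "hyp_sum r Y"
    have sub: "vec.subspace ?S" "vec.subspace ?T" "vec.subspace (hyp_sum r (X \<inter> Y))"
      using subspace_hyp_sum[OF P] that by blast+
    \<comment> \<open>The intersection of the two subspaces is exactly the one for
      \<open>X \<union> Y\<close>, whereas their sum is only contained in the one for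
      \<open>X \<inter> Y\<close>; this is why an inequality results.\<close>
    have "?S \<subseteq> hyp_sum r (X \<inter> Y)" "?T \<subseteq> hyp_sum r (X \<inter> Y)" by (auto simp: hyp_sum_eq)
    then have "{x + y | x y. x \<in> ?S \<and> y \<in> ?T} \<subseteq> hyp_sum r (X \<inter> Y)"
      using sub(3) by (blast intro: vec.subspace_add)
    then have "vec.dim {x + y | x y. x \<in> ?S \<and> y \<in> ?T} \<le> vec.dim (hyp_sum r (X \<inter> Y))"
      by (rule vec.dim_subset)
    moreover have "?S \<inter> ?T = hyp_sum r (X \<union> Y)" by (auto simp: hyp_sum_eq)
    ultimately show ?thesis
      using vec.dim_sums_Int[OF sub(1,2)] dim_hyp_sum[of r X] dim_hyp_sum[of r Y]
        dim_hyp_sum[of r "X \<union> Y"] dim_hyp_sum[of r "X \<inter> Y"] by simp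
  qed
qed

lemma subspace_hyp_inter:
  assumes "hyperplanes r P" "H \<subseteq> P"
  shows "vec.subspace (hyp_inter r H \<alpha>)"
proof -
  have "hyp_inter r H \<alpha> = block_space r \<alpha> \<inter> hyp_sum r {h \<in> H. fst h = \<alpha>}"
    by (auto simp: hyp_inter_def hyp_sum_eq hyp_lift_def block_proj_of_block_space)
  moreover have "vec.subspace (hyp_sum r {h \<in> H. fst h = \<alpha>})"
    by (rule subspace_hyp_sum[OF assms(1)]) (use assms(2) in auto)
  ultimately show ?thesis by (simp add: block_space_subspace vec.subspace_inter)
qed

text \<open>The whole space and \<open>X(H)\<close> are both direct sums over the blocks, so
  codimensions add blockwise.\<close>

lemma hyp_codim_eq_sum:
  fixes H :: "('p::finite \<times> ('a::field^'n::finite) set) set"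
  assumes "hyperplanes r P" "H \<subseteq> P"
  shows "hyp_codim r H =
    (\<Sum>\<alpha>\<in>UNIV. vec.dim (block_space r \<alpha> :: ('a^'n) set) - vec.dim (hyp_inter r H \<alpha>))"
proof -
  have "block_sum (block_space r) = (UNIV :: ('a^'n) set)"
    by (subst block_sum_eq[of _ r]) (auto simp: block_proj_in_block_space)
  then have "CARD('n) = (\<Sum>\<alpha>\<in>UNIV. vec.dim (block_space r \<alpha> :: ('a^'n) set))"
    using dim_block_sum[of "block_space r :: _ \<Rightarrow> ('a^'n) set" r] 
    by (simp add: block_space_subspace card_cart_basis)
  moreover have "vec.dim (hyp_sum r H) = (\<Sum>\<alpha>\<in>UNIV. vec.dim (hyp_inter r H \<alpha>))"
    unfolding hyp_sum_def
    by (rule dim_block_sum[of _ r]) (simp_all add: subspace_hyp_inter[OF assms], auto simp: hyp_inter_def)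
  moreover have "vec.dim (hyp_inter r H \<alpha>) \<le> vec.dim (block_space r \<alpha> :: ('a^'n) set)" for \<alpha>
    by (rule vec.dim_subset) (auto simp: hyp_inter_def)
  ultimately show ?thesis by (simp add: hyp_codim_def sum_subtractf_nat)
qed

text \<open>Independence asks for equality in every block, the right-hand side only for equality of
  the totals. They agree because in each block the codimension is at most the number of
  hyperplanes.\<close>

lemma hyp_indep_iff:
  fixes H :: "('p::finite \<times> ('a::field^'n::finite) set) set"
  assumes P: "hyperplanes r P" "finite P" and H: "H \<subseteq> P"
  shows "hyp_indep r P H \<longleftrightarrow> hyp_codim r H = card H"
proof -
  let ?f = "\<lambda>H \<alpha>. vec.dim (block_space r \<alpha> :: ('a^'n) set) - vec.dim (hyp_inter r H \<alpha>)"
  let ?H = "\<lambda>\<alpha>. Pair \<alpha> ` {\<pi>. (\<alpha>, \<pi>) \<in> H}"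
  have fin: "finite {\<pi>. (\<alpha>, \<pi>) \<in> H}" for \<alpha>
    by (rule finite_subset[OF _ finite_imageI[OF finite_subset[OF H P(2)], of snd]]) force
  have H_sub: "?H \<alpha> \<subseteq> P" for \<alpha> using H by auto
  have "card H = card (SIGMA \<alpha>:UNIV. {\<pi>. (\<alpha>, \<pi>) \<in> H})" by (rule arg_cong[where f = card]) auto
  then have card: "card H = (\<Sum>\<alpha>\<in>UNIV. card {\<pi>. (\<alpha>, \<pi>) \<in> H})" using fin by simp
  have le: "?f H \<alpha> \<le> card {\<pi>. (\<alpha>, \<pi>) \<in> H}" for \<alpha>
  proof -
    \<comment> \<open>The bound for one block is the global bound applied to the members of
      \<open>H\<close> tagged with \<open>\<alpha>\<close>.\<close>
    have "?f H \<alpha> = ?f (?H \<alpha>) \<alpha>" by (simp add: hyp_inter_def image_iff)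
    also have "\<dots> \<le> (\<Sum>\<alpha>'\<in>UNIV. ?f (?H \<alpha>) \<alpha>')" by (rule member_le_sum) auto
    also have "\<dots> = hyp_codim r (?H \<alpha>)" using hyp_codim_eq_sum[OF P(1) H_sub] by simp
    also have "\<dots> \<le> card (?H \<alpha>)"
      using matroid_rank_le_card[OF matroid_rank_hyp_codim[OF P(1)] _ H_sub] fin by blast
    also have "\<dots> = card {\<pi>. (\<alpha>, \<pi>) \<in> H}" by (simp add: card_image inj_on_def)
    finally show ?thesis .
  qed
  have "(\<Sum>\<alpha>\<in>UNIV. ?f H \<alpha>) = (\<Sum>\<alpha>\<in>UNIV. card {\<pi>. (\<alpha>, \<pi>) \<in> H}) \<longleftrightarrow>
      (\<forall>\<alpha>. ?f H \<alpha> = card {\<pi>. (\<alpha>, \<pi>) \<in> H})"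
    using le sum_mono_inv[of "?f H" UNIV "\<lambda>\<alpha>. card {\<pi>. (\<alpha>, \<pi>) \<in> H}"] by auto
  then show ?thesis
    unfolding hyp_indep_def card hyp_codim_eq_sum[OF P(1) H] using H by (simp add: eq_commute)
qed

lemma rank_of_hyp_indep:
  assumes "hyperplanes r P" "finite P" "H \<subseteq> P"
  shows "rank_of (hyp_indep r P) H = hyp_codim r H"
proof (rule rank_of_eq_matroid_rank)
  show "finite H" using assms finite_subset by blast
  show "matroid_rank H (hyp_codim r)"
    using matroid_rank_subset[OF matroid_rank_hyp_codim] assms by blast
  show "hyp_indep r P I \<longleftrightarrow> hyp_codim r I = card I" if "I \<subseteq> H" for I
    using hyp_indep_iff[OF assms(1,2)] that assms(3) by blast
qed

section \<open>Stable pairs, covers and matchings\<close>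

text \<open>A basis of the row space has at most one element, so all rows are multiples of one
  vector \<open>v\<close>; if the basis is empty, any \<open>v\<close> serves.\<close>

lemma rank_le_1_outer:
  fixes B :: "'a::field^'m::finite^'n::finite"
  assumes "rank B \<le> 1"
  obtains u v where "\<And>i j. B $ i $ j = u $ i * v $ j"
proof -
  obtain S where S: "S \<subseteq> rows B" "rows B \<subseteq> vec.span S" "vec.independent S" "card S = rank B"
    unfolding row_rank_def_gen using vec.basis_exists by metis
  have "finite S" using S(3) by (rule vec.finiteI_independent)
  then obtain v where "S \<subseteq> {v}"
    using assms S(4) by (metis card_0_eq card_1_singletonE empty_subsetI le_antisym less_one linorder_not_le order_refl)
  then have "rows B \<subseteq> vec.span {v}" using S(2) vec.span_mono by blast
  moreover have "B $ i \<in> rows B" for i by (auto simp: rows_def row_def)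
  ultimately have "\<forall>i. \<exists>k. B $ i = k *s v" by (auto simp: vec.span_singleton)
  then obtain k where "\<And>i. B $ i = k i *s v" by metis
  then have "B $ i $ j = (\<chi> i. k i) $ i * v $ j" for i j by simp
  then show ?thesis by (rule that)
qed

lemma bilin_alt: "bilin A x y = (\<Sum>i\<in>UNIV. \<Sum>j\<in>UNIV. x $ i * A $ i $ j * y $ j)"
  by (simp add: bilin_def matrix_vector_mult_def sum_distrib_left mult.assoc)

lemma bilin_transpose: "bilin A x y = (\<Sum>j\<in>UNIV. (transpose A *v x) $ j * y $ j)"
  unfolding bilin_alt
  by (subst sum.swap)
    (simp add: matrix_vector_mult_def transpose_def sum_distrib_left sum_distrib_right ac_simps)

lemma bilin_block_proj:
  "bilin A (block_proj r \<alpha> x) (block_proj c \<beta> y) = bilin (block A r c \<alpha> \<beta>) x y"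
  unfolding bilin_alt by (intro sum.cong) (auto simp: block_proj_def block_def)

lemma bilin_sum_blocks:
  "bilin A x y = (\<Sum>\<alpha>\<in>UNIV. \<Sum>\<beta>\<in>UNIV. bilin (block A r c \<alpha> \<beta>) x y)"
proof -
  have "bilin A (\<Sum>\<alpha>\<in>I. f \<alpha>) z = (\<Sum>\<alpha>\<in>I. bilin A (f \<alpha>) z)" for I z and f :: "_ \<Rightarrow> _"
    by (simp add: bilin_def sum_distrib_right sum.swap[of _ UNIV])
  moreover have "bilin A z (\<Sum>\<beta>\<in>I. f \<beta>) = (\<Sum>\<beta>\<in>I. bilin A z (f \<beta>))" for I z and f :: "_ \<Rightarrow> _"
    by (simp add: bilin_transpose sum_distrib_left sum.swap[of _ UNIV])
  ultimately show ?thesis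
    unfolding bilin_block_proj[symmetric]
    by (metis (no_types, lifting) sum.cong sum_block_proj)
qed

lemma outer_kernels:
  assumes "rank (block A r c \<alpha> \<beta>) \<noteq> 0"
    and B: "\<And>i j. block A r c \<alpha> \<beta> $ i $ j = u $ i * v $ j"
  shows "left_ker A r c \<alpha> \<beta> = {x \<in> block_space r \<alpha>. (\<Sum>i\<in>UNIV. u $ i * x $ i) = 0}"
    and "right_ker A r c \<alpha> \<beta> = {y \<in> block_space c \<beta>. (\<Sum>j\<in>UNIV. v $ j * y $ j) = 0}"
proof -
  \<comment> \<open>A nonzero entry gives nonzero coordinates of \<open>u\<close> and of
    \<open>v\<close>. Each product with the block is a fixed vector times a linear form, so it
    vanishes only where the form does.\<close>
  have "block A r c \<alpha> \<beta> \<noteq> 0"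
    using assms(1) by (auto simp: row_rank_def_gen rows_def row_def)
  then obtain i j where "u $ i \<noteq> 0" "v $ j \<noteq> 0"
    using B by (metis mult_eq_0_iff vec_eq_iff zero_index)
  moreover have "(transpose (block A r c \<alpha> \<beta>) *v x) $ j = v $ j * (\<Sum>i\<in>UNIV. u $ i * x $ i)" for x j
    by (simp add: matrix_vector_mult_def transpose_def B sum_distrib_left algebra_simps)
  moreover have "(block A r c \<alpha> \<beta> *v y) $ i = u $ i * (\<Sum>j\<in>UNIV. v $ j * y $ j)" for y i
    by (simp add: matrix_vector_mult_def B sum_distrib_left algebra_simps)
  ultimately show "left_ker A r c \<alpha> \<beta> = {x \<in> block_space r \<alpha>. (\<Sum>i\<in>UNIV. u $ i * x $ i) = 0}"
    "right_ker A r c \<alpha> \<beta> = {y \<in> block_space c \<beta>. (\<Sum>j\<in>UNIV. v $ j * y $ j) = 0}"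
    unfolding left_ker_def right_ker_def by (auto simp: vec_eq_iff)
qed

lemma hyperplanes_row_hyps: "hyperplanes r (row_hyps A r c)"
  unfolding hyperplanes_def row_hyps_def
proof safe
  fix \<alpha> \<beta> assume rank: "rank (block A r c \<alpha> \<beta>) = 1"
  then obtain u v where uv: "\<And>i j. block A r c \<alpha> \<beta> $ i $ j = u $ i * v $ j"
    using rank_le_1_outer[of "block A r c \<alpha> \<beta>"] by auto
  have "rank (block A r c \<alpha> \<beta>) \<noteq> 0" using rank by simp
  then show "\<exists>u. left_ker A r c \<alpha> \<beta> = {x \<in> block_space r \<alpha>. (\<Sum>i\<in>UNIV. u $ i * x $ i) = 0}"
    using outer_kernels(1)[OF _ uv] by blast
qed

lemma hyperplanes_col_hyps: "hyperplanes c (col_hyps A r c)"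
  unfolding hyperplanes_def col_hyps_def
proof safe
  fix \<alpha> \<beta> assume rank: "rank (block A r c \<alpha> \<beta>) = 1"
  then obtain u v where uv: "\<And>i j. block A r c \<alpha> \<beta> $ i $ j = u $ i * v $ j"
    using rank_le_1_outer[of "block A r c \<alpha> \<beta>"] by auto
  have "rank (block A r c \<alpha> \<beta>) \<noteq> 0" using rank by simp
  then show "\<exists>u. right_ker A r c \<alpha> \<beta> = {x \<in> block_space c \<beta>. (\<Sum>i\<in>UNIV. u $ i * x $ i) = 0}"
    using outer_kernels(2)[OF _ uv] by blast
qed

section \<open>Stable pairs versus covers\<close>

text \<open>Closure under projections allows stability of a pair to be tested on a single
  block.\<close>

lemma block_subspaces_subspace:
  assumes "X \<in> block_subspaces r"
  shows "vec.subspace X" "x \<in> X \<Longrightarrow> block_proj r \<alpha> x \<in> X"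
proof -
  obtain Z where Z: "X = block_sum Z" "\<And>\<alpha>. vec.subspace (Z \<alpha>)" "\<And>\<alpha>. Z \<alpha> \<subseteq> block_space r \<alpha>"
    using assms by (auto simp: block_subspaces_def)
  have X: "X = {x. \<forall>\<alpha>. block_proj r \<alpha> x \<in> Z \<alpha>}" unfolding Z(1) by (rule block_sum_eq[OF Z(3)])
  show "vec.subspace X"
    using Z(2) unfolding X vec.subspace_def
    by (simp add: block_proj_0 block_proj_add block_proj_scale)
  show "block_proj r \<alpha> x \<in> X" if "x \<in> X"
    using that Z(2) unfolding X by (simp add: block_proj_block_proj vec.subspace_0)
qed

lemma hyp_sum_in_block_subspaces:
  assumes "hyperplanes r P" "H \<subseteq> P"
  shows "hyp_sum r H \<in> block_subspaces r"
  unfolding block_subspaces_def hyp_sum_def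
  using subspace_hyp_inter[OF assms] by (auto simp: hyp_inter_def)

lemma stable_pair_imp_cover:
  assumes rank: "\<forall>\<alpha> \<beta>. rank (block A r c \<alpha> \<beta>) \<le> 1" and st: "stable_pair A r c X Y"
  shows "\<exists>H K. cover A r c H K \<and> X \<subseteq> hyp_sum r H \<and> Y \<subseteq> hyp_sum c K"
proof -
  \<comment> \<open>All hyperplanes containing \<open>X\<close> or \<open>Y\<close> are taken, so
    the enclosing pair is as small as possible and covering is the only thing to check.\<close>
  define H where "H = {h \<in> row_hyps A r c. X \<subseteq> hyp_lift r h}"
  define K where "K = {h \<in> col_hyps A r c. Y \<subseteq> hyp_lift c h}"
  have "(\<alpha>, \<pi>) \<in> H \<or> (\<beta>, \<sigma>) \<in> K" if e: "((\<alpha>, \<pi>), (\<beta>, \<sigma>)) \<in> edges A r c" for \<alpha> \<pi> \<beta> \<sigma>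
  proof (rule ccontr)
    have e: "(\<alpha>, \<pi>) \<in> row_hyps A r c" "(\<beta>, \<sigma>) \<in> col_hyps A r c"
      "\<pi> = left_ker A r c \<alpha> \<beta>" "\<sigma> = right_ker A r c \<alpha> \<beta>"
      using e by (auto simp: edges_def)
    assume "\<not> ((\<alpha>, \<pi>) \<in> H \<or> (\<beta>, \<sigma>) \<in> K)"
    then obtain x y where xy: "x \<in> X" "block_proj r \<alpha> x \<notin> \<pi>" "y \<in> Y" "block_proj c \<beta> y \<notin> \<sigma>"
      using e by (auto simp: H_def K_def hyp_lift_def)
    obtain u v where B: "\<And>i j. block A r c \<alpha> \<beta> $ i $ j = u $ i * v $ j"
      using rank_le_1_outer rank by metis
    let ?x = "block_proj r \<alpha> x" and ?y = "block_proj c \<beta> y"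
    have "transpose (block A r c \<alpha> \<beta>) *v ?x \<noteq> 0" "block A r c \<alpha> \<beta> *v ?y \<noteq> 0"
      using xy by (auto simp: e left_ker_def right_ker_def block_proj_in_block_space)
    moreover have "(transpose (block A r c \<alpha> \<beta>) *v ?x) $ j = v $ j * (\<Sum>i\<in>UNIV. u $ i * ?x $ i)" for j
      by (simp add: matrix_vector_mult_def transpose_def B sum_distrib_left algebra_simps)
    moreover have "(block A r c \<alpha> \<beta> *v ?y) $ i = u $ i * (\<Sum>j\<in>UNIV. v $ j * ?y $ j)" for i
      by (simp add: matrix_vector_mult_def B sum_distrib_left algebra_simps)
    ultimately have "(\<Sum>i\<in>UNIV. u $ i * ?x $ i) \<noteq> 0" "(\<Sum>j\<in>UNIV. v $ j * ?y $ j) \<noteq> 0"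
      by (auto simp: vec_eq_iff)
    \<comment> \<open>On the block of an uncovered edge the form is a product of two nonzero
      scalars, although both projections stay in the stable pair.\<close>
    moreover have "bilin (block A r c \<alpha> \<beta>) ?x ?y = (\<Sum>i\<in>UNIV. u $ i * ?x $ i) * (\<Sum>j\<in>UNIV. v $ j * ?y $ j)"
      unfolding bilin_alt sum_product B by (simp add: ac_simps)
    ultimately have "bilin A ?x ?y \<noteq> 0"
      using bilin_block_proj[of A r \<alpha> ?x c \<beta> ?y] by (simp add: block_proj_block_proj)
    moreover have "?x \<in> X" "?y \<in> Y"
      using st xy block_subspaces_subspace(2) by (auto simp: stable_pair_def)
    ultimately show False using st by (simp add: stable_pair_def)
  qed
  moreover have "H \<subseteq> row_hyps A r c" "K \<subseteq> col_hyps A r c" by (auto simp: H_def K_def)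
  ultimately have "cover A r c H K" unfolding cover_def by auto
  moreover have "X \<subseteq> hyp_sum r H" "Y \<subseteq> hyp_sum c K" by (auto simp: hyp_sum_eq H_def K_def)
  ultimately show ?thesis by blast
qed

text \<open>A block of rank 0 contributes nothing to the form. A block of rank 1 gives an edge, and
  its covered endpoint places one of the two projections in a kernel of the block.\<close>

lemma cover_imp_stable_pair:
  assumes rank: "\<forall>\<alpha> \<beta>. rank (block A r c \<alpha> \<beta>) \<le> 1" and cov: "cover A r c H K"
  shows "stable_pair A r c (hyp_sum r H) (hyp_sum c K)"
proof -
  have HK: "H \<subseteq> row_hyps A r c" "K \<subseteq> col_hyps A r c" using cov by (auto simp: cover_def)
  have "bilin (block A r c \<alpha> \<beta>) x y = 0" if x: "x \<in> hyp_sum r H" and y: "y \<in> hyp_sum c K" for \<alpha> \<beta> x y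
  proof (cases "rank (block A r c \<alpha> \<beta>) = 0")
    case True
    then have "block A r c \<alpha> \<beta> $ i = 0" for i
      by (auto simp: row_rank_def_gen rows_def row_def)
    then show ?thesis by (simp add: bilin_alt)
  next
    case False
    then have "rank (block A r c \<alpha> \<beta>) = 1" using rank by (metis One_nat_def le_SucE le_zero_eq)
    then have "((\<alpha>, left_ker A r c \<alpha> \<beta>), (\<beta>, right_ker A r c \<alpha> \<beta>)) \<in> edges A r c"
      by (auto simp: edges_def row_hyps_def col_hyps_def)
    then have "(\<alpha>, left_ker A r c \<alpha> \<beta>) \<in> H \<or> (\<beta>, right_ker A r c \<alpha> \<beta>) \<in> K"
      using cov by (auto simp: cover_def)
    then have "block_proj r \<alpha> x \<in> left_ker A r c \<alpha> \<beta> \<or> block_proj c \<beta> y \<in> right_ker A r c \<alpha> \<beta>"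
      using x y by (force simp: hyp_sum_eq hyp_lift_def)
    then have "bilin (block A r c \<alpha> \<beta>) (block_proj r \<alpha> x) (block_proj c \<beta> y) = 0"
    proof
      assume "block_proj r \<alpha> x \<in> left_ker A r c \<alpha> \<beta>"
      then show ?thesis unfolding left_ker_def bilin_transpose by simp
    next
      assume "block_proj c \<beta> y \<in> right_ker A r c \<alpha> \<beta>"
      then show ?thesis unfolding right_ker_def bilin_def by simp
    qed
    then show ?thesis
      unfolding bilin_block_proj[symmetric] by (simp add: block_proj_block_proj)
  qed
  then have "bilin A x y = 0" if "x \<in> hyp_sum r H" "y \<in> hyp_sum c K" for x y
    unfolding bilin_sum_blocks[of A x y r c] using that by simp
  then show ?thesis
    using hyp_sum_in_block_subspaces hyperplanes_row_hyps hyperplanes_col_hyps HK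
    unfolding stable_pair_def by metis
qed

section \<open>Duality between covers and independent matchings\<close>

lemma cover_rank_eq:
  assumes "cover A r c H K"
  shows "cover_rank A r c H K = hyp_codim r H + hyp_codim c K"
  using assms unfolding cover_rank_def row_indep_def col_indep_def cover_def
  by (simp add: rank_of_hyp_indep hyperplanes_row_hyps hyperplanes_col_hyps finite_row_hyps finite_col_hyps)

text \<open>Weak duality: each edge of \<open>M\<close> has an endpoint in \<open>H\<close> or in
  \<open>K\<close>. The endpoints are distinct on either side and independent, so those in
  \<open>H\<close> number at most the rank of \<open>H\<close>, and likewise for
  \<open>K\<close>.\<close>

lemma indep_matching_le_cover:
  assumes M: "indep_matching A r c M" and cov: "cover A r c H K"
  shows "card M \<le> cover_rank A r c H K"
proof -
  have E: "M \<subseteq> edges A r c" and inj: "inj_on fst M" "inj_on snd M"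
    using M by (auto simp: indep_matching_def matching_def inj_on_def)
  have finM: "finite M" using E finite_edges finite_subset by blast
  have sub: "fst ` M \<subseteq> row_hyps A r c" "snd ` M \<subseteq> col_hyps A r c" using E by (auto simp: edges_def)
  have HK: "H \<subseteq> row_hyps A r c" "K \<subseteq> col_hyps A r c" using cov by (auto simp: cover_def)
  note mr = matroid_rank_hyp_codim[OF hyperplanes_row_hyps[of r A c]]
    and mc = matroid_rank_hyp_codim[OF hyperplanes_col_hyps[of c A r]]
  have "hyp_codim r (fst ` M) = card (fst ` M)" "hyp_codim c (snd ` M) = card (snd ` M)"
    using M hyp_indep_iff[OF hyperplanes_row_hyps finite_row_hyps sub(1)]
      hyp_indep_iff[OF hyperplanes_col_hyps finite_col_hyps sub(2)]
    by (simp_all add: indep_matching_def row_indep_def col_indep_def)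
  then have "hyp_codim r (fst ` M \<inter> H) = card (fst ` M \<inter> H)"
    "hyp_codim c (snd ` M \<inter> K) = card (snd ` M \<inter> K)"
    using matroid_rank_indep_subset[OF mr _ sub(1)] matroid_rank_indep_subset[OF mc _ sub(2)] finM by auto
  moreover have "hyp_codim r (fst ` M \<inter> H) \<le> hyp_codim r H" "hyp_codim c (snd ` M \<inter> K) \<le> hyp_codim c K"
    using matroid_rank_mono[OF mr _ HK(1)] matroid_rank_mono[OF mc _ HK(2)] by auto
  moreover have "fst e \<in> H \<or> snd e \<in> K" if "e \<in> M" for e
    using cov subsetD[OF E that] unfolding cover_def by (cases e) auto
  then have "M = {e \<in> M. fst e \<in> H} \<union> {e \<in> M. snd e \<in> K}" by auto
  then have "card M \<le> card {e \<in> M. fst e \<in> H} + card {e \<in> M. snd e \<in> K}"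
    using card_Un_le[of "{e \<in> M. fst e \<in> H}" "{e \<in> M. snd e \<in> K}"] by simp
  moreover have "fst ` M \<inter> H = fst ` {e \<in> M. fst e \<in> H}" "snd ` M \<inter> K = snd ` {e \<in> M. snd e \<in> K}"
    by auto
  then have "card (fst ` M \<inter> H) = card {e \<in> M. fst e \<in> H}"
    "card (snd ` M \<inter> K) = card {e \<in> M. snd e \<in> K}"
    using inj by (simp_all add: card_image inj_on_def)
  ultimately show ?thesis by (simp add: cover_rank_eq[OF cov])
qed

text \<open>Strong duality: an edge set \<open>F\<close> minimizing \<open>f F + g (?E - F)\<close>
  yields a cover from the row ends of \<open>F\<close> and the column ends of its complement, and
  matroid intersection supplies a matching of that size.\<close>

lemma exists_indep_matching_eq_cover:
  fixes A :: "'a::field^'m::finite^'n::finite"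
    and r :: "'n \<Rightarrow> 'p::finite" and c :: "'m \<Rightarrow> 'q::finite"
  shows "\<exists>M H K. indep_matching A r c M \<and> cover A r c H K \<and> card M = cover_rank A r c H K"
proof -
  let ?E = "edges A r c"
  define f where "f F = hyp_codim r (fst ` F)" for F :: "(('p \<times> ('a^'n) set) \<times> ('q \<times> ('a^'m) set)) set"
  define g where "g F = hyp_codim c (snd ` F)" for F :: "(('p \<times> ('a^'n) set) \<times> ('q \<times> ('a^'m) set)) set"
  have sub: "fst ` ?E \<subseteq> row_hyps A r c" "snd ` ?E \<subseteq> col_hyps A r c" by (auto simp: edges_def)
  note mr = matroid_rank_hyp_codim[OF hyperplanes_row_hyps[of r A c]]
    and mc = matroid_rank_hyp_codim[OF hyperplanes_col_hyps[of c A r]]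
  have fg: "matroid_rank ?E f" "matroid_rank ?E g"
    unfolding f_def[abs_def] g_def[abs_def]
    using matroid_rank_image[OF mr sub(1)] matroid_rank_image[OF mc sub(2)] by blast+
  define F where "F = arg_min_on (\<lambda>F. f F + g (?E - F)) (Pow ?E)"
  have fin: "finite (Pow ?E)" using finite_edges by blast
  have F: "F \<subseteq> ?E" unfolding F_def using arg_min_if_finite(1)[OF fin] by blast
  have "f F + g (?E - F) \<le> f F' + g (?E - F')" if "F' \<subseteq> ?E" for F'
    unfolding F_def using arg_min_least[OF fin, of F' "\<lambda>F. f F + g (?E - F)"] that by blast
  then obtain M where M: "M \<subseteq> ?E" "card M = f F + g (?E - F)" "f M = card M" "g M = card M"
    using matroid_intersection[OF finite_edges fg] by metis
  have finM: "finite M" using M(1) finite_edges finite_subset by blast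
  have Msub: "fst ` M \<subseteq> row_hyps A r c" "snd ` M \<subseteq> col_hyps A r c" using M(1) sub by blast+
  \<comment> \<open>Rank is at most cardinality of the image, so neither endpoint map can identify
    two edges of \<open>M\<close>; hence \<open>M\<close> is a matching.\<close>
  have "card M \<le> card (fst ` M)" "card M \<le> card (snd ` M)"
    using matroid_rank_le_card[OF mr _ Msub(1)] matroid_rank_le_card[OF mc _ Msub(2)] finM M(3,4)
    by (simp_all add: f_def g_def)
  then have card: "card (fst ` M) = card M" "card (snd ` M) = card M"
    using card_image_le[OF finM] by (metis le_antisym)+
  then have inj: "inj_on fst M" "inj_on snd M" using finM eq_card_imp_inj_on by blast+
  have "matching ?E M"
    unfolding matching_def using M(1) inj by (auto dest: inj_onD)
  moreover have "row_indep A r c (fst ` M)" "col_indep A r c (snd ` M)"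
    using hyp_indep_iff[OF hyperplanes_row_hyps finite_row_hyps Msub(1)]
      hyp_indep_iff[OF hyperplanes_col_hyps finite_col_hyps Msub(2)] card M(3,4)
    by (simp_all add: row_indep_def col_indep_def f_def g_def)
  ultimately have "indep_matching A r c M" by (simp add: indep_matching_def)
  moreover have cov: "cover A r c (fst ` F) (snd ` (?E - F))"
    unfolding cover_def
  proof (intro conjI ballI)
    show "fst ` F \<subseteq> row_hyps A r c" "snd ` (?E - F) \<subseteq> col_hyps A r c" using F sub by auto
    show "case e of (\<pi>, \<sigma>) \<Rightarrow> \<pi> \<in> fst ` F \<or> \<sigma> \<in> snd ` (?E - F)" if "e \<in> ?E" for e
      using that by (cases e; cases "e \<in> F") (auto intro: rev_image_eqI)
  qed
  moreover have "card M = cover_rank A r c (fst ` F) (snd ` (?E - F))"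
    using M(2) by (simp add: cover_rank_eq[OF cov] f_def g_def)
  ultimately show ?thesis by blast
qed

theorem theorem4p1:
  fixes A :: "'a::field^'m::finite^'n::finite"
    and r :: "'n \<Rightarrow> 'p::finite" and c :: "'m \<Rightarrow> 'q::finite"
  assumes "\<forall>\<alpha> \<beta>. rank (block A r c \<alpha> \<beta>) \<le> 1"
  shows "(\<forall>X Y. stable_pair A r c X Y \<longrightarrow>
            (maximum_stable_pair A r c X Y \<longleftrightarrow>
              (\<exists>H K. minimum_cover A r c H K \<and> X = hyp_sum r H \<and> Y = hyp_sum c K)))
       \<and> int (Max {vec.dim X + vec.dim Y | X Y. stable_pair A r c X Y}) =
            int (CARD('n) + CARD('m)) - int (Max {card M | M. indep_matching A r c M})"
proof -
  \<comment> \<open>The dimension of the pair of a cover and the rank of the cover have constant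
    sum, so maximizing one is minimizing the other.\<close>
  have dim: "vec.dim (hyp_sum r H) + vec.dim (hyp_sum c K) + cover_rank A r c H K = CARD('n) + CARD('m)"
    if "cover A r c H K" for H K
    using dim_hyp_sum[of r H] dim_hyp_sum[of c K] cover_rank_eq[OF that] by simp
  have bound: "vec.dim X + vec.dim Y \<le> vec.dim (hyp_sum r H) + vec.dim (hyp_sum c K)"
    if st: "stable_pair A r c X Y" and min: "minimum_cover A r c H K" for X Y H K
  proof -
    obtain H' K' where HK': "cover A r c H' K'" "X \<subseteq> hyp_sum r H'" "Y \<subseteq> hyp_sum c K'"
      using stable_pair_imp_cover[OF assms st] by blast
    have "vec.dim X + vec.dim Y \<le> vec.dim (hyp_sum r H') + vec.dim (hyp_sum c K')"
      using HK'(2,3) by (intro add_mono vec.dim_subset)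
    moreover have "cover A r c H K" "cover_rank A r c H K \<le> cover_rank A r c H' K'"
      using min HK'(1) by (auto simp: minimum_cover_def)
    ultimately show ?thesis using dim[OF HK'(1)] dim[of H K] by linarith
  qed
  have max_min: "\<exists>H K. minimum_cover A r c H K \<and> X = hyp_sum r H \<and> Y = hyp_sum c K"
    if max: "maximum_stable_pair A r c X Y" for X Y
  proof -
    have st: "stable_pair A r c X Y" using max by (simp add: maximum_stable_pair_def)
    obtain H K where HK: "cover A r c H K" "X \<subseteq> hyp_sum r H" "Y \<subseteq> hyp_sum c K"
      using stable_pair_imp_cover[OF assms st] by blast
    have le: "vec.dim (hyp_sum r H') + vec.dim (hyp_sum c K') \<le> vec.dim X + vec.dim Y"
      if "cover A r c H' K'" for H' K'
      using max cover_imp_stable_pair[OF assms that] by (simp add: maximum_stable_pair_def)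
    have XY: "vec.dim X \<le> vec.dim (hyp_sum r H)" "vec.dim Y \<le> vec.dim (hyp_sum c K)"
      using HK by (auto intro: vec.dim_subset)
    note sub = block_subspaces_subspace(1)
    \<comment> \<open>The enclosing pair is stable, so its total dimension is not larger; as neither
      component is smaller, the dimensions agree in each component.\<close>
    have "vec.dim (hyp_sum r H) \<le> vec.dim X" "vec.dim (hyp_sum c K) \<le> vec.dim Y"
      using le[OF HK(1)] XY by linarith+
    then have eq: "X = hyp_sum r H" "Y = hyp_sum c K"
      using st cover_imp_stable_pair[OF assms HK(1)]
        vec.subspace_dim_equal[OF sub sub HK(2)] vec.subspace_dim_equal[OF sub sub HK(3)]
      unfolding stable_pair_def by blast+
    have "cover_rank A r c H K \<le> cover_rank A r c H' K'" if "cover A r c H' K'" for H' K'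
      using le[OF that] dim[OF that] dim[OF HK(1)] eq by simp
    then have "minimum_cover A r c H K" using HK(1) by (simp add: minimum_cover_def)
    then show ?thesis using eq by blast
  qed
  obtain M H K where MHK: "indep_matching A r c M" "cover A r c H K" "card M = cover_rank A r c H K"
    using exists_indep_matching_eq_cover by blast
  \<comment> \<open>Equality in weak duality certifies both optima at once: \<open>M\<close> is a
    largest matching and \<open>(H, K)\<close> a minimum cover.\<close>
  have min: "minimum_cover A r c H K"
    unfolding minimum_cover_def using MHK indep_matching_le_cover[OF MHK(1)] by simp
  have "Max {card M | M. indep_matching A r c M} = card M"
  proof (rule Max_eqI[OF indep_matchings_wf(1)])
    show "n \<le> card M" if n: "n \<in> {card M | M. indep_matching A r c M}" for n
      using n indep_matching_le_cover[OF _ MHK(2)] unfolding MHK(3) by blast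
  qed (use MHK(1) in blast)
  moreover have "Max {vec.dim X + vec.dim Y | X Y. stable_pair A r c X Y}
      = vec.dim (hyp_sum r H) + vec.dim (hyp_sum c K)"
  proof (rule Max_eqI[OF stable_dims_wf(1)])
    show "n \<le> vec.dim (hyp_sum r H) + vec.dim (hyp_sum c K)"
      if n: "n \<in> {vec.dim X + vec.dim Y | X Y. stable_pair A r c X Y}" for n
      using n bound[OF _ min] by blast
  qed (use cover_imp_stable_pair[OF assms MHK(2)] in blast)
  moreover have "int (vec.dim (hyp_sum r H) + vec.dim (hyp_sum c K)) = int (CARD('n) + CARD('m)) - int (card M)"
    using dim[OF MHK(2)] MHK(3) by linarith
  ultimately show ?thesis
    using max_min bound by (auto simp: maximum_stable_pair_def)
qed

end
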